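(* For every integer $n\geq1$, $N_o^+(n)=G(n)$, where $N_o^+(n)$ is the number of partitions of $n$ whose rank is positive and odd, and $G(n)$ is the number of partitions of $n$ into parts of two colors (red and blue) such that the smallest part is even, say equal to $2m$, and every red part is even and lies in the interval $(2m,4m]$.
   Context: The rank of a partition is its largest part minus its number of parts. In the two-color partitions counted by $G(n)$, parts of different colors are distinguished and the order of parts is irrelevant; blue parts are unrestricted apart from being at least the smallest part. For example $G(8)=7$, counting $8_b,\ 6_b+2_b,\ 4_b+4_b,\ 4_b+2_b+2_b,\ 2_b+2_b+2_b+2_b,\ 3_b+3_b+2_b,\ 4_r+2_b+2_b$. Equivalently, $\sum_{n\ge1}G(n)q^n=\sum_{m=1}^\infty\frac{q^{2m}}{(q^{2m+2};q^2)_m(q^{2m};q)_\infty}$, with $(A;q)_N=\prod_{j=0}^{N-1}(1-Aq^j)$ and $(A;q)_\infty=\prod_{j\ge0}(1-Aq^j)$. *)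

theory Defs
  imports "HOL-Library.Multiset"
begin

definition int_partitions :: "nat \<Rightarrow> nat multiset set" where
  "int_partitions n = {p. (\<forall>k \<in># p. 0 < k) \<and> sum_mset p = n}"

(* Only meaningful for nonempty p, since Max is unspecified on the empty set. *)
definition partition_rank :: "nat multiset \<Rightarrow> int" where
  "partition_rank p = int (Max (set_mset p)) - int (size p)"

definition No_plus :: "nat \<Rightarrow> nat" where
  "No_plus n = card {p \<in> int_partitions n. 0 < partition_rank p \<and> odd (partition_rank p)}"

datatype part_color = Red | Blue

definition two_color_partitions :: "nat \<Rightarrow> (part_color \<times> nat) multiset set" where
  "two_color_partitions n =
    {p. (\<forall>x \<in># p. 0 < snd x) \<and> sum_mset (image_mset snd p) = n}"

(* The smallest part is taken over all parts of both colors; as red parts must exceed it,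
   it is necessarily attained by a blue part. Only meaningful for nonempty p. *)
definition smallest_part :: "(part_color \<times> nat) multiset \<Rightarrow> nat" where
  "smallest_part p = Min (snd ` set_mset p)"

definition G_count :: "nat \<Rightarrow> nat" where
  "G_count n = card {p \<in> two_color_partitions n.
     \<exists>m. smallest_part p = 2 * m \<and>
         (\<forall>k. (Red, k) \<in># p \<longrightarrow> even k \<and> k \<in> {2 * m <.. 4 * m})}"

end

theory Submission
  imports Defs "HOL-Computational_Algebra.Formal_Laurent_Series"
begin

text \<open>
  Write \<open>(q)\<^sub>n = (1 - q) \<dots> (1 - q ^ n)\<close> and \<open>(-q)\<^sub>n = (1 + q) \<dots> (1 + q ^ n)\<close>. Conjugation
  negates the rank, so \<open>4 N\<^sub>o\<^sup>+(n)\<close> is the number of partitions of \<open>n\<close> minus their signed count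
  by the parity of the rank, and sorting by the largest part turns the signed count into the
  coefficients of \<open>\<Sum>l\<ge>1. (-1) ^ (l - 1) q ^ l / (-q)\<^sub>l\<close>. By a Rogers-Fine iteration this equals
  \<open>\<Sum>n\<ge>1. q ^ n\<^sup>2 / (-q)\<^sub>n\<^sup>2\<close>. On the other side, \<open>G\<close> has generating function
  \<open>D / (q)\<^sub>\<infinity>\<close> with \<open>D = \<Sum>m\<ge>1. q ^ (2 m) (q\<^sup>2; q\<^sup>2)\<^bsub>m-1\<^esub> / (-q)\<^bsub>2m\<^esub>\<close>. If \<open>D\<^sub>M\<close> is the
  \<open>M\<close>-th partial sum of \<open>D\<close>, then \<open>X\<^sub>M = (1 - 4 D\<^sub>M) (-q)\<^bsub>2M\<^esub> / (q\<^sup>2; q\<^sup>2)\<^sub>M\<close> satisfies a first-order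
  recurrence, whose solution \<open>X\<^sub>M = \<Sum>n\<le>M. q ^ n\<^sup>2 (q\<^sup>2; q\<^sup>2)\<^sub>M / ((q\<^sup>2; q\<^sup>2)\<^bsub>M-n\<^esub> (-q)\<^sub>n\<^sup>2)\<close> agrees with
  \<open>\<Sum>n\<ge>0. q ^ n\<^sup>2 / (-q)\<^sub>n\<^sup>2\<close> up to the power \<open>2 M\<close>. All identities are therefore needed only in
  finite form.
\<close>

subsection \<open>q-series identities in a field\<close>

text \<open>Defined over a commutative ring because \<open>bounded_gf_qfact\<close> applies it to
  formal power series.\<close>

definition qfact :: "'a::comm_ring_1 \<Rightarrow> nat \<Rightarrow> 'a" where
  "qfact q n = (\<Prod>k=1..n. 1 - q ^ k)"

definition qfact_plus :: "'a::field \<Rightarrow> nat \<Rightarrow> 'a" where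
  "qfact_plus q n = (\<Prod>k=1..n. 1 + q ^ k)"

lemma qfact_simps [simp]: "qfact q 0 = 1" "qfact q (Suc n) = qfact q n * (1 - q ^ Suc n)"
  by (simp_all add: qfact_def)

lemma qfact_plus_simps [simp]:
  "qfact_plus q 0 = 1" "qfact_plus q (Suc n) = qfact_plus q n * (1 + q ^ Suc n)"
  by (simp_all add: qfact_plus_def)

lemma qfact_mult_qfact_plus: "qfact q n * qfact_plus q n = qfact (q\<^sup>2) n"
  unfolding qfact_def qfact_plus_def prod.distrib [symmetric]
  by (intro prod.cong) (simp_all add: algebra_simps power2_eq_square power_mult_distrib)

lemma qfact_split:
  assumes "0 < m" "m \<le> n"
  shows "qfact q n = qfact q (m - 1) * (\<Prod>k=m..n. 1 - q ^ k)"
proof -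
  have "{1..n} = {1..m - 1} \<union> {m..n}" "{1..m - 1} \<inter> {m..n} = {}"
    using assms by auto
  then show ?thesis
    unfolding qfact_def by (simp add: prod.union_disjoint)
qed

lemma qfact_square_double:
  "qfact (q\<^sup>2) (m + n) = qfact (q\<^sup>2) m * (\<Prod>j=1..n. 1 - q ^ (2 * (m + j)))"
  by (induction n) (simp_all add: mult.assoc del: power_Suc flip: power_mult)

text \<open>Finite form of the summand q^(n^2) / (-q)_n^2 of Ramanujan's third-order mock theta
  function f(q). The extra quotient is a product of n factors 1 - q^(2j) and tends formally to 1 as
  M grows. Meant for n <= M: beyond that, truncated subtraction gives M - n = 0 and does not make
  the term vanish.\<close>

definition durfee_term :: "'a::field \<Rightarrow> nat \<Rightarrow> nat \<Rightarrow> 'a" where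
  "durfee_term q M n = q ^ n\<^sup>2 * qfact (q\<^sup>2) M / (qfact (q\<^sup>2) (M - n) * (qfact_plus q n)\<^sup>2)"

locale q_generic =
  fixes q :: "'a::field"
  assumes power_neq_1: "\<And>k. 0 < k \<Longrightarrow> q ^ k \<noteq> 1"
begin

lemma one_minus_power_neq_0: "0 < k \<Longrightarrow> 1 - q ^ k \<noteq> 0"
  using power_neq_1[of k] by auto

text \<open>If q^k = -1 then q^(2k) = 1, so excluding roots of unity keeps these factors nonzero
  too.\<close>

lemma one_plus_power_neq_0: "0 < k \<Longrightarrow> 1 + q ^ k \<noteq> 0"
proof
  assume "0 < k" "1 + q ^ k = 0"
  then have "q ^ k = - 1" by (metis add_eq_0_iff)
  then have "q ^ (2 * k) = 1" by (simp add: mult.commute[of 2] power_mult)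
  then show False using power_neq_1[of "2 * k"] \<open>0 < k\<close> by simp
qed

lemma prod_one_minus_power_neq_0: "(\<And>k. k \<in> A \<Longrightarrow> 0 < f k) \<Longrightarrow> (\<Prod>k\<in>A. 1 - q ^ f k) \<noteq> 0"
  by (induction A rule: infinite_finite_induct) (use one_minus_power_neq_0 in simp_all)

lemma qfact_neq_0: "qfact q n \<noteq> 0"
  using one_minus_power_neq_0 by (auto simp: qfact_def)

lemma qfact_square_neq_0: "qfact (q\<^sup>2) n \<noteq> 0"
  using one_minus_power_neq_0[of "2 * k" for k] by (auto simp: qfact_def power_mult [symmetric])

lemma qfact_plus_neq_0: "qfact_plus q n \<noteq> 0"
  using one_plus_power_neq_0 by (auto simp: qfact_plus_def)

section \<open>Recurrence in M for the sums of \<open>durfee_term\<close>\<close>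

lemma durfee_term_Suc:
  assumes "k < M"
  shows "durfee_term q M (Suc k) =
    durfee_term q M k * (q * (q ^ k)\<^sup>2 * (1 - q ^ (2 * (M - k))) / (1 + q ^ Suc k)\<^sup>2)"
proof -
  obtain d where M: "M = Suc (k + d)"
    using assms less_imp_Suc_add by blast
  have n: "qfact (q\<^sup>2) d \<noteq> 0" "qfact_plus q k \<noteq> 0" "1 + q ^ Suc k \<noteq> 0"
      "1 - q ^ (2 * Suc d) \<noteq> 0"
    using qfact_square_neq_0 qfact_plus_neq_0 one_plus_power_neq_0[of "Suc k"]
      one_minus_power_neq_0[of "2 * Suc d"] by simp_all
  have e: "qfact (q\<^sup>2) (Suc d) = qfact (q\<^sup>2) d * (1 - q ^ (2 * Suc d))"
    by (simp only: qfact_simps power_mult)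
  have e2: "qfact_plus q (Suc k) = qfact_plus q k * (1 + q ^ Suc k)"
    by simp
  have e3: "q ^ (Suc k)\<^sup>2 = q ^ k\<^sup>2 * (q * (q ^ k)\<^sup>2)"
    by (simp add: power2_eq_square power_add algebra_simps)
  have d: "M - Suc k = d" "M - k = Suc d" by (simp_all add: M)
  show ?thesis
    unfolding durfee_term_def d e e2 e3 power_mult_distrib using n
    by (simp add: divide_simps del: power_Suc qfact_simps qfact_plus_simps)
qed

text \<open>Together with \<open>durfee_term_Suc\<close> this writes both new terms of the
  telescoping step as rational multiples of \<open>durfee_term q M k\<close>, which makes the
  certificate checkable by polynomial arithmetic.\<close>

lemma durfee_term_Suc_Suc:
  assumes "k \<le> M"
  shows "durfee_term q (Suc M) (Suc k) =
    durfee_term q M k * (q * (q ^ k)\<^sup>2 * (1 - q ^ (2 * Suc M)) / (1 + q ^ Suc k)\<^sup>2)"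
proof -
  have n: "qfact (q\<^sup>2) (M - k) \<noteq> 0" "qfact_plus q k \<noteq> 0" "1 + q ^ Suc k \<noteq> 0"
    using qfact_square_neq_0 qfact_plus_neq_0 one_plus_power_neq_0[of "Suc k"] by simp_all
  have e: "qfact (q\<^sup>2) (Suc M) = qfact (q\<^sup>2) M * (1 - q ^ (2 * Suc M))"
    by (simp only: qfact_simps power_mult)
  have e2: "qfact_plus q (Suc k) = qfact_plus q k * (1 + q ^ Suc k)"
    by simp
  have e3: "q ^ (Suc k)\<^sup>2 = q ^ k\<^sup>2 * (q * (q ^ k)\<^sup>2)"
    by (simp add: power2_eq_square power_add algebra_simps)
  have d: "Suc M - Suc k = M - k" by simp
  show ?thesis
    unfolding durfee_term_def d e e2 e3 power_mult_distrib using n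
    by (simp add: divide_simps del: power_Suc qfact_simps qfact_plus_simps)
qed

lemma durfee_term_0: "durfee_term q M 0 = 1"
  using qfact_square_neq_0 by (simp add: durfee_term_def)

text \<open>
  The right-hand side is a q-Zeilberger certificate for the recurrence of \<open>X\<^sub>M\<close>.
\<close>

lemma durfee_telescope:
  assumes "k \<le> M"
  shows "(\<Sum>n\<le>k. (1 - q ^ (2 * Suc M)) * durfee_term q (Suc M) n
              - (1 + q ^ (2 * M + 1)) * (1 + q ^ (2 * Suc M)) * durfee_term q M n)
    = durfee_term q M k * (2 * q ^ (2 * Suc M) * q ^ k - (1 + q ^ (2 * Suc M)) * q ^ (2 * M + 1))
      - 4 * q ^ (2 * Suc M)"
  using assms
proof (induction k)
  case 0
  show ?case
    by (simp add: durfee_term_0 algebra_simps)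
next
  case (Suc k)
  \<comment> \<open>Since q^(2M) = v * y^2, every new term is s times a rational function of q, y
    and v whose only denominator is (1 + q*y)^2.\<close>
  define s y v where "s = durfee_term q M k" and "y = q ^ k" and "v = q ^ (2 * (M - k))"
  have "2 * M + 1 = 2 * (M - k) + 2 * k + 1" "2 * Suc M = 2 * (M - k) + 2 * k + 2"
    using Suc.prems by simp_all
  then have u: "q ^ (2 * M + 1) = v * y\<^sup>2 * q" "q ^ (2 * Suc M) = v * y\<^sup>2 * q\<^sup>2"
    by (simp_all only: power_add v_def y_def power_mult power_one_right) (simp_all add: power_mult [symmetric] mult.commute)
  have nz: "1 + q * y \<noteq> 0"
    using one_plus_power_neq_0[of "Suc k"] by (simp add: y_def)
  have "(1 - v * y\<^sup>2 * q\<^sup>2) * (s * (q * y\<^sup>2 * (1 - v * y\<^sup>2 * q\<^sup>2) / (1 + q * y)\<^sup>2))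
       - (1 + v * y\<^sup>2 * q) * (1 + v * y\<^sup>2 * q\<^sup>2) * (s * (q * y\<^sup>2 * (1 - v) / (1 + q * y)\<^sup>2))
     = s * (q * y\<^sup>2 * (1 - v) / (1 + q * y)\<^sup>2)
         * (2 * (v * y\<^sup>2 * q\<^sup>2) * (q * y) - (1 + v * y\<^sup>2 * q\<^sup>2) * (v * y\<^sup>2 * q))
       - s * (2 * (v * y\<^sup>2 * q\<^sup>2) * y - (1 + v * y\<^sup>2 * q\<^sup>2) * (v * y\<^sup>2 * q))"
    using nz by (simp add: divide_simps) algebra
  moreover have "durfee_term q (Suc M) (Suc k) = s * (q * y\<^sup>2 * (1 - v * y\<^sup>2 * q\<^sup>2) / (1 + q * y)\<^sup>2)"
    using durfee_term_Suc_Suc[of k M] Suc.prems u(2) by (simp add: s_def y_def)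
  moreover have "durfee_term q M (Suc k) = s * (q * y\<^sup>2 * (1 - v) / (1 + q * y)\<^sup>2)"
    using durfee_term_Suc[of k M] Suc.prems by (simp add: s_def y_def v_def)
  ultimately show ?case
    using Suc.IH Suc.prems unfolding sum.atMost_Suc u
    by (simp add: s_def [symmetric] y_def [symmetric])
qed

text \<open>Telescoping up to n = M stops one term short of the sum for \<open>Suc M\<close>. That
  last term cancels the boundary multiple of \<open>durfee_term q M M\<close>, so only -4 q^(2M+2)
  survives.\<close>

lemma durfee_sum_rec:
  "(1 - q ^ (2 * Suc M)) * (\<Sum>n\<le>Suc M. durfee_term q (Suc M) n)
    = (1 + q ^ (2 * M + 1)) * (1 + q ^ (2 * Suc M)) * (\<Sum>n\<le>M. durfee_term q M n)
      - 4 * q ^ (2 * Suc M)"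
proof -
  define s y where "s = durfee_term q M M" and "y = q ^ M"
  have u: "q ^ (2 * M + 1) = y\<^sup>2 * q" "q ^ (2 * Suc M) = y\<^sup>2 * q\<^sup>2"
    by (simp_all add: y_def power_even_eq power2_eq_square)
  have nz: "1 + q * y \<noteq> 0"
    using one_plus_power_neq_0[of "Suc M"] by (simp add: y_def)
  have "durfee_term q (Suc M) (Suc M) = s * (q * y\<^sup>2 * (1 - y\<^sup>2 * q\<^sup>2) / (1 + q * y)\<^sup>2)"
    using durfee_term_Suc_Suc[of M M] u(2) by (simp add: s_def y_def)
  \<comment> \<open>Cancelling (1 + q*y)^2 turns the first product into s*q*y^2*(1 - q*y)^2, the
    negative of the boundary term.\<close>
  moreover have "(1 - y\<^sup>2 * q\<^sup>2) * (s * (q * y\<^sup>2 * (1 - y\<^sup>2 * q\<^sup>2) / (1 + q * y)\<^sup>2))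
      + s * (2 * (y\<^sup>2 * q\<^sup>2) * y - (1 + y\<^sup>2 * q\<^sup>2) * (y\<^sup>2 * q)) = 0"
    using nz by (simp add: divide_simps) algebra
  moreover have "(1 - y\<^sup>2 * q\<^sup>2) * (\<Sum>n\<le>M. durfee_term q (Suc M) n)
      - (1 + y\<^sup>2 * q) * (1 + y\<^sup>2 * q\<^sup>2) * (\<Sum>n\<le>M. durfee_term q M n)
      = s * (2 * (y\<^sup>2 * q\<^sup>2) * y - (1 + y\<^sup>2 * q\<^sup>2) * (y\<^sup>2 * q)) - 4 * (y\<^sup>2 * q\<^sup>2)"
    using durfee_telescope[of M M]
    unfolding u sum_subtractf sum_distrib_left [symmetric] s_def [symmetric] y_def [symmetric]
    by simp
  ultimately show ?thesis
    unfolding u sum.atMost_Suc by algebra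
qed

text \<open>Passing from M to M+1 multiplies the two factorials on the right by exactly the factors
  occurring in \<open>durfee_sum_rec\<close>; its inhomogeneous term -4 q^(2M+2) becomes the new
  summand on the left.\<close>

lemma durfee_sum_eq:
  "1 - 4 * (\<Sum>m=1..M. q ^ (2 * m) * qfact (q\<^sup>2) (m - 1) / qfact_plus q (2 * m))
    = (\<Sum>n\<le>M. durfee_term q M n) * qfact (q\<^sup>2) M / qfact_plus q (2 * M)"
proof (induction M)
  case 0
  show ?case by (simp add: durfee_term_0)
next
  case (Suc M)
  define a b X X' u w where "a = qfact (q\<^sup>2) M" and "b = qfact_plus q (2 * M)"
    and "X = (\<Sum>n\<le>M. durfee_term q M n)" and "X' = (\<Sum>n\<le>Suc M. durfee_term q (Suc M) n)"
    and "u = q ^ (2 * Suc M)" and "w = q ^ (2 * M + 1)"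
  have b': "qfact_plus q (2 * Suc M) = b * (1 + w) * (1 + u)"
    by (simp add: b_def u_def w_def)
  have a': "qfact (q\<^sup>2) (Suc M) = a * (1 - u)"
    by (simp only: qfact_simps a_def u_def power_mult)
  have nz: "b \<noteq> 0" "1 + w \<noteq> 0" "1 + u \<noteq> 0"
    using qfact_plus_neq_0 one_plus_power_neq_0[of "2 * M + 1"] one_plus_power_neq_0[of "2 * Suc M"]
    by (simp_all add: b_def u_def w_def)
  have "(1 - u) * X' = (1 + w) * (1 + u) * X - 4 * u"
    using durfee_sum_rec[of M] by (simp only: X_def X'_def u_def w_def)
  then have "X' * (a * (1 - u)) / (b * (1 + w) * (1 + u)) = X * a / b - 4 * (u * a / (b * (1 + w) * (1 + u)))"
    using nz by (simp add: divide_simps) algebra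
  moreover have "1 - 4 * (\<Sum>m=1..M. q ^ (2 * m) * qfact (q\<^sup>2) (m - 1) / qfact_plus q (2 * m)) = X * a / b"
    using Suc.IH by (simp only: X_def a_def b_def)
  moreover have "(\<Sum>m=1..Suc M. q ^ (2 * m) * qfact (q\<^sup>2) (m - 1) / qfact_plus q (2 * m))
      = (\<Sum>m=1..M. q ^ (2 * m) * qfact (q\<^sup>2) (m - 1) / qfact_plus q (2 * m))
        + u * a / (b * (1 + w) * (1 + u))"
    by (simp add: b_def w_def u_def a_def)
  ultimately show ?case
    unfolding X'_def [symmetric] a' b' by (simp add: ring_distribs)
qed


text \<open>Dividing \<open>durfee_sum_eq\<close> by (q)_(2M) turns the m-th summand into a
  generating function: q^(2m) stands for a compulsory blue part 2m, the factors with k in 2m..2M for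
  the blue parts, and those with 2(m+j) for the red parts.\<close>

lemma two_color_sum_eq:
  "4 * (\<Sum>m=1..M. q ^ (2 * m) * (\<Prod>k=2*m..2*M. inverse (1 - q ^ k))
          * (\<Prod>j=1..m. inverse (1 - q ^ (2 * (m + j)))))
    = (\<Prod>k=1..2*M. inverse (1 - q ^ k))
      - (\<Sum>n\<le>M. durfee_term q M n) * (\<Prod>j=1..M. inverse (1 - q ^ (2 * (M + j))))"
proof -
  have summand: "q ^ (2 * m) * (\<Prod>k=2*m..2*M. inverse (1 - q ^ k))
          * (\<Prod>j=1..m. inverse (1 - q ^ (2 * (m + j))))
        = q ^ (2 * m) * qfact (q\<^sup>2) (m - 1) / qfact_plus q (2 * m) / qfact q (2 * M)"
    if "m \<in> {1..M}" for m
  proof -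
    have "m \<noteq> 0"
      using that by simp
    then obtain m' where m: "m = Suc m'"
      using not0_implies_Suc by blast
    define A B where "A = (\<Prod>k=2*m..2*M. 1 - q ^ k)" and "B = (\<Prod>j=1..m. 1 - q ^ (2 * (m + j)))"
    have nz: "A \<noteq> 0" "B \<noteq> 0"
      unfolding A_def B_def by (rule prod_one_minus_power_neq_0, use m in simp)+
    have QM: "qfact q (2 * M) = qfact q (2 * m - 1) * A"
      using qfact_split[of "2 * m" "2 * M"] that by (simp add: A_def)
    have "qfact (q\<^sup>2) m = qfact (q\<^sup>2) (m - 1) * (1 - q ^ (2 * m))"
      by (simp only: m qfact_simps diff_Suc_1 power_mult)
    moreover have "qfact q (2 * m) = qfact q (2 * m - 1) * (1 - q ^ (2 * m))"
      by (simp add: m)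
    \<comment> \<open>The product (q)_(2m) (-q)_(2m) = (q^2; q^2)_(2m) is split at m. The factor 1 -
      q^(2m), common to (q)_(2m) and (q^2; q^2)_m, is then cancelled, leaving the factorial of index
      m - 1.\<close>
    moreover have "qfact q (2 * m) * qfact_plus q (2 * m) = qfact (q\<^sup>2) m * B"
      using qfact_square_double[of q m m] by (simp add: qfact_mult_qfact_plus B_def mult_2)
    ultimately have "(1 - q ^ (2 * m)) * (qfact q (2 * m - 1) * qfact_plus q (2 * m))
        = (1 - q ^ (2 * m)) * (qfact (q\<^sup>2) (m - 1) * B)"
      by (simp only: mult_ac)
    then have "qfact q (2 * m - 1) * qfact_plus q (2 * m) = qfact (q\<^sup>2) (m - 1) * B"
      using one_minus_power_neq_0[of "2 * m"] that by simp
    then have "qfact q (2 * M) * qfact_plus q (2 * m) = A * B * qfact (q\<^sup>2) (m - 1)"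
      using QM by (simp add: mult_ac)
    then show ?thesis
      unfolding prod_inversef [unfolded o_def] A_def [symmetric] B_def [symmetric]
      using nz qfact_neq_0 qfact_plus_neq_0 qfact_square_neq_0
      by (simp add: divide_simps mult_ac)
  qed
  define S X where "S = (\<Sum>m=1..M. q ^ (2 * m) * qfact (q\<^sup>2) (m - 1) / qfact_plus q (2 * m))"
    and "X = (\<Sum>n\<le>M. durfee_term q M n)"
  define B where "B = (\<Prod>j=1..M. 1 - q ^ (2 * (M + j)))"
  have nzB: "B \<noteq> 0"
    unfolding B_def by (rule prod_one_minus_power_neq_0) simp
  \<comment> \<open>The same doubling with m = M: dividing (q^2; q^2)_M / (-q)_(2M) by (q)_(2M)
    leaves 1 / B.\<close>
  have "qfact q (2 * M) * qfact_plus q (2 * M) = qfact (q\<^sup>2) M * B"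
    using qfact_square_double[of q M M] by (simp add: qfact_mult_qfact_plus B_def mult_2)
  moreover have "1 - 4 * S = X * qfact (q\<^sup>2) M / qfact_plus q (2 * M)"
    unfolding S_def X_def by (rule durfee_sum_eq)
  ultimately have "1 / qfact q (2 * M) - 4 * S / qfact q (2 * M) = X / B"
    using nzB qfact_neq_0[of "2 * M"] qfact_plus_neq_0[of "2 * M"] by (simp add: divide_simps) algebra
  moreover have "(\<Sum>m=1..M. q ^ (2 * m) * (\<Prod>k=2*m..2*M. inverse (1 - q ^ k))
          * (\<Prod>j=1..m. inverse (1 - q ^ (2 * (m + j))))) = S / qfact q (2 * M)"
    unfolding S_def sum_divide_distrib by (intro sum.cong refl summand)
  moreover have "(\<Prod>k=1..2*M. inverse (1 - q ^ k)) = inverse (qfact q (2 * M))"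
    "(\<Prod>j=1..M. inverse (1 - q ^ (2 * (M + j)))) = inverse B"
    unfolding qfact_def B_def by (rule prod_inversef [unfolded o_def])+
  ultimately show ?thesis
    unfolding X_def [symmetric] by (simp only:) (simp add: divide_inverse algebra_simps)
qed

text \<open>Here only factors 1 + q^k are inverted. They are units as power series, so this form can
  leave the field.\<close>

lemma durfee_term_eq:
  assumes "n \<le> M"
  shows "durfee_term q M n = q ^ n\<^sup>2 * (\<Prod>j=M-n+1..M. 1 - q ^ (2 * j)) * (\<Prod>k=1..n. inverse (1 + q ^ k))\<^sup>2"
proof -
  have "{1..M} = {1..M - n} \<union> {M-n+1..M}" "{1..M - n} \<inter> {M-n+1..M} = {}"
    using assms by auto
  then have "qfact (q\<^sup>2) M = qfact (q\<^sup>2) (M - n) * (\<Prod>j=M-n+1..M. 1 - q ^ (2 * j))"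
    unfolding qfact_def by (simp add: prod.union_disjoint power_mult)
  then show ?thesis
    unfolding durfee_term_def qfact_plus_def
    using qfact_square_neq_0[of "M - n"]
    unfolding prod_inversef [unfolded o_def] by (simp add: divide_inverse power_inverse mult_ac)
qed

section \<open>Rogers-Fine iteration with explicit truncation errors\<close>

definition shifted_prod :: "nat \<Rightarrow> nat \<Rightarrow> 'a" where
  "shifted_prod n l = (\<Prod>k<l. inverse (1 + q ^ (n + Suc k)))"

lemma shifted_prod_0 [simp]: "shifted_prod n 0 = 1"
  by (simp add: shifted_prod_def)

lemma shifted_prod_Suc: "shifted_prod n (Suc l) = shifted_prod n l * inverse (1 + q ^ (n + Suc l))"
  by (simp add: shifted_prod_def)

lemma shifted_prod_Suc_shift:
  "shifted_prod n (Suc l) = inverse (1 + q ^ Suc n) * shifted_prod (Suc n) l"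
  unfolding shifted_prod_def prod.lessThan_Suc_shift by simp

text \<open>Partial sum of the Rogers-Fine function F(a,b;t), the sum of (aq)_l t^l / (bq)_l, at a =
  0 and b = t = -q^n.\<close>

definition alternating_tail :: "nat \<Rightarrow> nat \<Rightarrow> 'a" where
  "alternating_tail L n = (\<Sum>l\<le>L. (- 1) ^ l * q ^ (n * l) * shifted_prod n l)"

text \<open>One step of the iteration. Cutting the series at L costs exactly its first omitted
  summand, which is subtracted from 1.\<close>

lemma alternating_tail_rec:
  "(1 + q ^ n) * alternating_tail L n =
     1 - (- 1) ^ Suc L * q ^ (n * Suc L) * shifted_prod n (Suc L)
     + q ^ (2 * n + 1) * inverse (1 + q ^ Suc n) * alternating_tail L (Suc n)"
proof (induction L)
  case 0
  define z where "z = q ^ n"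
  have "1 + q * z \<noteq> 0"
    using one_plus_power_neq_0[of "Suc n"] by (simp add: z_def)
  then have "(1 + q * z) * inverse (1 + q * z) = 1"
    by simp
  then have "1 + z = 1 + z * inverse (1 + q * z) + z * z * q * inverse (1 + q * z)"
    by algebra
  then show ?case
    by (simp add: alternating_tail_def shifted_prod_Suc z_def power_mult power2_eq_square mult_ac)
next
  case (Suc L)
  define h y z where "h = shifted_prod n (Suc L)" and "y = (-1) ^ Suc L * q ^ (n * Suc L)" and "z = q ^ n"
  define w where "w = q ^ (Suc n + Suc L)"
  have nz: "1 + w \<noteq> 0"
    unfolding w_def by (rule one_plus_power_neq_0) simp
  have t: "alternating_tail L' n' = alternating_tail L n' + (- 1) ^ Suc L * q ^ (n' * Suc L) * shifted_prod n' (Suc L)"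
    if "L' = Suc L" for n' L'
    by (simp add: alternating_tail_def that)
  have h': "shifted_prod n (Suc (Suc L)) = h * inverse (1 + w)"
    by (simp add: shifted_prod_Suc h_def w_def)
  have "q ^ (2 * n + 1) * inverse (1 + q ^ Suc n) * ((- 1) ^ Suc L * q ^ (Suc n * Suc L) * shifted_prod (Suc n) (Suc L))
      = q ^ (2 * n + 1) * ((- 1) ^ Suc L * q ^ (Suc n * Suc L)) * shifted_prod n (Suc (Suc L))"
    unfolding shifted_prod_Suc_shift[of n "Suc L"] by (simp add: mult_ac)
  also have "\<dots> = y * z * w * (h * inverse (1 + w))"
    unfolding h' by (simp add: y_def z_def w_def power_add power_mult power2_eq_square mult_ac)
  finally have a: "q ^ (2 * n + 1) * inverse (1 + q ^ Suc n) * ((- 1) ^ Suc L * q ^ (Suc n * Suc L) * shifted_prod (Suc n) (Suc L))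
      = y * z * w * (h * inverse (1 + w))" .
  have b: "(- 1) ^ Suc (Suc L) * q ^ (n * Suc (Suc L)) = - y * z"
    by (simp add: y_def z_def power_add mult_ac)
  have "(1 + w) * inverse (1 + w) = 1"
    using nz by simp
  \<comment> \<open>The new summand on the left splits in three: y*h cancels the old error, the
    second piece is the new error, and the third is the new summand of the tail on the
    right.\<close>
  then have c: "(1 + z) * (y * h) = y * h + y * z * (h * inverse (1 + w)) + y * z * w * (h * inverse (1 + w))"
    by algebra
  show ?case
    unfolding t[OF refl] distrib_left a b h' Suc.IH
    using c by (simp add: h_def [symmetric] y_def [symmetric] z_def [symmetric] algebra_simps del: power_Suc mult_Suc_right)
qed

text \<open>The recurrence is iterated N times from n = 1. The factors q^(2n+1) accumulate to
  q^(n^2), and each 1 + q^n is divided out twice: on entering the tail of index n and on solving for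
  it. This yields the squares.\<close>

lemma alternating_sum_eq:
  "(\<Sum>l=1..Suc L. (- 1) ^ (l - 1) * q ^ l * (\<Prod>k=1..l. inverse (1 + q ^ k)))
    = (\<Sum>n=1..N. q ^ n\<^sup>2 * (1 - (- 1) ^ Suc L * q ^ (n * Suc L) * (\<Prod>k<Suc L. inverse (1 + q ^ (n + Suc k))))
          * (\<Prod>k=1..n. inverse (1 + q ^ k))\<^sup>2)
      + q ^ (Suc N)\<^sup>2 * (\<Prod>k=1..N. inverse (1 + q ^ k))\<^sup>2 * inverse (1 + q ^ Suc N)
          * (\<Sum>l\<le>L. (- 1) ^ l * q ^ (Suc N * l) * (\<Prod>k<l. inverse (1 + q ^ (Suc N + Suc k))))"
proof -
  have "(\<Sum>l=1..Suc L. (- 1) ^ (l - 1) * q ^ l * (\<Prod>k=1..l. inverse (1 + q ^ k)))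
      = (\<Sum>l\<le>L. (- 1) ^ l * q ^ Suc l * shifted_prod 0 (Suc l))"
    unfolding shifted_prod_def
    by (simp add: sum.atLeast1_atMost_eq prod.atLeast1_atMost_eq lessThan_Suc_atMost del: power_Suc prod.lessThan_Suc sum.cl_ivl_Suc)
  also have "\<dots> = q * inverse (1 + q) * alternating_tail L 1"
    by (simp add: alternating_tail_def shifted_prod_Suc_shift sum_distrib_left mult_ac)
  also have "\<dots> = (\<Sum>n=1..N. q ^ n\<^sup>2 * (1 - (- 1) ^ Suc L * q ^ (n * Suc L) * shifted_prod n (Suc L))
          * (\<Prod>k=1..n. inverse (1 + q ^ k))\<^sup>2)
      + q ^ (Suc N)\<^sup>2 * (\<Prod>k=1..N. inverse (1 + q ^ k))\<^sup>2 * inverse (1 + q ^ Suc N) * alternating_tail L (Suc N)"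
  proof (induction N)
    case 0
    show ?case by simp
  next
    case (Suc N)
    define p t t' z g where "p = (\<Prod>k=1..N. inverse (1 + q ^ k))" and "t = alternating_tail L (Suc N)"
      and "t' = alternating_tail L (Suc (Suc N))" and "z = 1 + q ^ Suc N"
      and "g = 1 - (- 1) ^ Suc L * q ^ (Suc N * Suc L) * shifted_prod (Suc N) (Suc L)"
    define a b where "a = q ^ (Suc N)\<^sup>2" and "b = inverse (1 + q ^ Suc (Suc N))"
    have "z \<noteq> 0"
      unfolding z_def by (rule one_plus_power_neq_0) simp
    moreover have "z * t = g + q ^ (2 * Suc N + 1) * b * t'"
      unfolding z_def t_def t'_def g_def b_def by (rule alternating_tail_rec)
    ultimately have "t = inverse z * (g + q ^ (2 * Suc N + 1) * b * t')"
      by (simp add: field_simps)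
    moreover have "q ^ (Suc (Suc N))\<^sup>2 = a * q ^ (2 * Suc N + 1)"
      unfolding a_def power_add [symmetric] by (rule arg_cong) (simp add: power2_eq_square)
    moreover have "(\<Prod>k=1..Suc N. inverse (1 + q ^ k)) = p * inverse z"
      by (simp add: p_def z_def)
    moreover have "(\<Sum>n=1..Suc N. q ^ n\<^sup>2 * (1 - (- 1) ^ Suc L * q ^ (n * Suc L) * shifted_prod n (Suc L)) * (\<Prod>k=1..n. inverse (1 + q ^ k))\<^sup>2)
        = (\<Sum>n=1..N. q ^ n\<^sup>2 * (1 - (- 1) ^ Suc L * q ^ (n * Suc L) * shifted_prod n (Suc L)) * (\<Prod>k=1..n. inverse (1 + q ^ k))\<^sup>2)
          + a * g * (p * inverse z)\<^sup>2"
      by (simp add: a_def g_def p_def z_def)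
    ultimately show ?case
      unfolding Suc.IH p_def [symmetric] t_def [symmetric] t'_def [symmetric] z_def [symmetric]
        a_def [symmetric] b_def [symmetric]
      by (simp add: algebra_simps power2_eq_square del: power_Suc sum.cl_ivl_Suc)
  qed
  finally show ?thesis
    unfolding alternating_tail_def shifted_prod_def .
qed

end

subsection \<open>Transfer to formal power series\<close>

text \<open>
  Formal power series are not a field, so identities between rational functions reach them through
  the field of Laurent series.
\<close>

lemma fps_to_fls_sum: "fps_to_fls (\<Sum>x\<in>A. f x) = (\<Sum>x\<in>A. fps_to_fls (f x))"
  by (induction A rule: infinite_finite_induct) simp_all

lemma fps_to_fls_prod:
  fixes f :: "'b \<Rightarrow> 'a::comm_ring_1 fps"
  shows "fps_to_fls (\<Prod>x\<in>A. f x) = (\<Prod>x\<in>A. fps_to_fls (f x))"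
  by (induction A rule: infinite_finite_induct) (simp_all add: fls_times_fps_to_fls)

text \<open>For k > 0 the constant coefficient is 1, so the power series inverse is a true inverse.
  For k = 0 both sides are the inverse of 0, which is 0.\<close>

lemma fps_to_fls_inverse_one_minus:
  "fps_to_fls (inverse (1 - fps_X ^ k :: 'a::field fps)) = inverse (1 - fls_X ^ k)"
proof (cases "k = 0")
  case False
  then have "subdegree (1 - fps_X ^ k :: 'a fps) = 0"
    by (intro subdegree_eq_0) simp
  then show ?thesis
    by (simp add: fls_inverse_fps_to_fls [symmetric] fps_to_fls_power)
qed simp

text \<open>Characteristic 0 covers k = 0, where the constant coefficient is 2.\<close>

lemma fps_to_fls_inverse_one_plus:
  "fps_to_fls (inverse (1 + fps_X ^ k :: 'a::field_char_0 fps)) = inverse (1 + fls_X ^ k)"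
proof -
  have "subdegree (1 + fps_X ^ k :: 'a fps) = 0"
    by (intro subdegree_eq_0) (cases "k = 0"; simp)
  then show ?thesis
    by (simp add: fls_inverse_fps_to_fls [symmetric] fps_to_fls_power)
qed

lemmas fps_to_fls_hom = fps_to_fls_sum fps_to_fls_prod fls_times_fps_to_fls fps_to_fls_power
  fps_to_fls_inverse_one_minus fps_to_fls_inverse_one_plus

interpretation fls_X: q_generic "fls_X :: rat fls"
proof
  fix k :: nat assume "0 < k"
  then have "fls_nth (fls_X ^ k :: rat fls) 0 \<noteq> fls_nth 1 0"
    by simp
  then show "(fls_X ^ k :: rat fls) \<noteq> 1"
    by metis
qed

lemma two_color_fps_eq:
  "4 * (\<Sum>m=1..M. fps_X ^ (2 * m) * (\<Prod>k=2*m..2*M. inverse (1 - fps_X ^ k))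
          * (\<Prod>j=1..m. inverse (1 - fps_X ^ (2 * (m + j)))))
    = (\<Prod>k=1..2*M. inverse (1 - fps_X ^ k))
      - (\<Sum>n\<le>M. fps_X ^ n\<^sup>2 * (\<Prod>j=M-n+1..M. 1 - fps_X ^ (2 * j)) * (\<Prod>k=1..n. inverse (1 + fps_X ^ k))\<^sup>2)
        * (\<Prod>j=1..M. inverse (1 - fps_X ^ (2 * (M + j)) :: rat fps))"
  (is "?l = ?r")
proof -
  have "fps_to_fls ?l = fps_to_fls ?r"
    using fls_X.two_color_sum_eq[of M] fls_X.durfee_term_eq[of _ M]
    by (simp add: fps_to_fls_hom)
  then show ?thesis by (simp only: fps_to_fls_eq_iff)
qed

lemma alternating_fps_eq:
  "(\<Sum>l=1..Suc L. (- 1) ^ (l - 1) * fps_X ^ l * (\<Prod>k=1..l. inverse (1 + fps_X ^ k)))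
    = (\<Sum>n=1..N. fps_X ^ n\<^sup>2 * (1 - (- 1) ^ Suc L * fps_X ^ (n * Suc L) * (\<Prod>k<Suc L. inverse (1 + fps_X ^ (n + Suc k))))
          * (\<Prod>k=1..n. inverse (1 + fps_X ^ k))\<^sup>2)
      + fps_X ^ (Suc N)\<^sup>2 * (\<Prod>k=1..N. inverse (1 + fps_X ^ k))\<^sup>2 * inverse (1 + fps_X ^ Suc N)
          * (\<Sum>l\<le>L. (- 1) ^ l * fps_X ^ (Suc N * l) * (\<Prod>k<l. inverse (1 + fps_X ^ (Suc N + Suc k) :: rat fps)))"
  (is "?l = ?r")
proof -
  have "fps_to_fls ?l = fps_to_fls ?r"
    using fls_X.alternating_sum_eq[of L N]
    by (simp only: fps_to_fls_hom fps_to_fls_plus fps_to_fls_minus fps_to_fls_uminus fps_one_to_fls fps_X_to_fls)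
  then show ?thesis by (simp only: fps_to_fls_eq_iff)
qed

section \<open>Comparing coefficients modulo powers of X\<close>

lemma fps_X_power_dvd_nth_eq:
  fixes f g :: "'a::comm_ring_1 fps"
  assumes "fps_X ^ K dvd f - g" "n < K"
  shows "f $ n = g $ n"
proof -
  from assms(1) obtain h where "f - g = fps_X ^ K * h" ..
  then have "(f - g) $ n = 0"
    using assms(2) by (simp add: fps_X_power_mult_nth)
  then show ?thesis by simp
qed

lemma dvd_mult_minus_1:
  fixes a b d :: "'a::comm_ring_1"
  assumes "d dvd a - 1" "d dvd b - 1"
  shows "d dvd a * b - 1"
proof -
  have "a * b - 1 = (a - 1) * b + (b - 1)"
    by (simp add: algebra_simps)
  with assms show ?thesis by (simp only: dvd_add dvd_mult2)
qed

lemma dvd_prod_minus_1: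
  fixes d :: "'a::comm_ring_1"
  assumes "\<And>x. x \<in> A \<Longrightarrow> d dvd f x - 1"
  shows "d dvd (\<Prod>x\<in>A. f x) - 1"
  using assms by (induction A rule: infinite_finite_induct) (simp_all add: dvd_mult_minus_1)

lemma dvd_inverse_one_minus_fps_X_power:
  assumes "0 < k" "K \<le> k"
  shows "fps_X ^ K dvd inverse (1 - fps_X ^ k :: 'a::field fps) - 1"
proof -
  have "(1 - fps_X ^ k :: 'a fps) $ 0 \<noteq> 0"
    using assms by simp
  then have "inverse (1 - fps_X ^ k) * (1 - fps_X ^ k :: 'a fps) = 1"
    by (rule inverse_mult_eq_1)
  then have "inverse (1 - fps_X ^ k :: 'a fps) - 1 = fps_X ^ k * inverse (1 - fps_X ^ k)"
    by (simp add: algebra_simps)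
  then show ?thesis
    using assms(2) by (simp add: le_imp_power_dvd)
qed

lemma durfee_nth_eq:
  "((\<Sum>k\<le>n. fps_X ^ k\<^sup>2 * (\<Prod>j=n-k+1..n. 1 - fps_X ^ (2 * j)) * p k)
        * (\<Prod>j=1..n. inverse (1 - fps_X ^ (2 * (n + j)) :: 'a::field fps))) $ n
    = (\<Sum>k\<le>n. fps_X ^ k\<^sup>2 * p k) $ n" (is "(?S * ?P) $ n = ?T $ n")
proof (rule fps_X_power_dvd_nth_eq)
  show "fps_X ^ Suc n dvd ?S * ?P - ?T"
  proof -
    have "fps_X ^ Suc n dvd ?P - 1"
      by (intro dvd_prod_minus_1 dvd_inverse_one_minus_fps_X_power) auto
    moreover have "fps_X ^ Suc n dvd ?S - ?T"
      unfolding sum_subtractf [symmetric]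
    proof (rule dvd_sum)
      fix k assume k: "k \<in> {..n}"
      define Q where "Q = (\<Prod>j=n-k+1..n. 1 - fps_X ^ (2 * j) :: 'a fps)"
      have "fps_X ^ (2 * (n - k + 1)) dvd Q - 1"
        unfolding Q_def
      proof (rule dvd_prod_minus_1)
        fix j assume "j \<in> {n-k+1..n}"
        then have "fps_X ^ (2 * (n - k + 1)) dvd (fps_X ^ (2 * j) :: 'a fps)"
          by (intro le_imp_power_dvd) simp
        then show "fps_X ^ (2 * (n - k + 1)) dvd (1 - fps_X ^ (2 * j) :: 'a fps) - 1"
          by (simp only: diff_diff_eq add.commute[of _ 1] minus_dvd_iff dvd_minus_iff diff_cancel) simp
      qed
      then have "fps_X ^ k\<^sup>2 * fps_X ^ (2 * (n - k + 1)) dvd fps_X ^ k\<^sup>2 * (Q - 1)"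
        by (rule mult_dvd_mono [OF dvd_refl])
      \<comment> \<open>From (k - 1)^2 >= 0 one gets k^2 + 2(n - k + 1) >= 2n + 1.\<close>
      moreover have "Suc n \<le> k\<^sup>2 + 2 * (n - k + 1)"
      proof -
        have "2 * int k \<le> (int k)\<^sup>2 + 1"
          using zero_le_power2[of "int k - 1"] by (simp add: power2_diff)
        then have "int (2 * k) \<le> int (k\<^sup>2 + 1)"
          by simp
        then have "2 * k \<le> k\<^sup>2 + 1"
          by (simp only: of_nat_le_iff)
        then show ?thesis using k by simp
      qed
      ultimately have "fps_X ^ Suc n dvd fps_X ^ k\<^sup>2 * (Q - 1)"
        unfolding power_add [symmetric] by (meson dvd_trans le_imp_power_dvd)
      then have "fps_X ^ Suc n dvd fps_X ^ k\<^sup>2 * (Q - 1) * p k"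
        by (rule dvd_mult2)
      then show "fps_X ^ Suc n dvd fps_X ^ k\<^sup>2 * (\<Prod>j=n-k+1..n. 1 - fps_X ^ (2 * j)) * p k - fps_X ^ k\<^sup>2 * p k"
        unfolding Q_def by (simp add: algebra_simps)
    qed
    moreover have "a * b - c = a * (b - 1) + (a - c)" for a b c :: "'a fps"
      by (simp add: algebra_simps)
    ultimately show ?thesis
      by (simp only: dvd_add dvd_mult)
  qed
qed simp

text \<open>In \<open>alternating_fps_eq\<close> take L + 1 = N = n. The remainder carries
  X^((n+1)^2) and the truncation errors carry X^(k^2 + k*n) with k >= 1, all beyond degree
  n.\<close>

lemma alternating_nth_eq:
  assumes "0 < n"
  shows "(\<Sum>l=1..n. (- 1) ^ (l - 1) * fps_X ^ l * (\<Prod>k=1..l. inverse (1 + fps_X ^ k :: rat fps))) $ n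
    = (\<Sum>k=1..n. fps_X ^ k\<^sup>2 * (\<Prod>j=1..k. inverse (1 + fps_X ^ j :: rat fps))\<^sup>2) $ n"
proof (rule fps_X_power_dvd_nth_eq)
  obtain L where L: "n = Suc L"
    using assms gr0_conv_Suc by blast
  define g p where "g k = (- 1) ^ n * (\<Prod>j<n. inverse (1 + fps_X ^ (k + Suc j) :: rat fps))"
    and "p k = (\<Prod>j=1..k. inverse (1 + fps_X ^ j :: rat fps))\<^sup>2" for k
  have "fps_X ^ Suc n dvd (fps_X :: rat fps) ^ (Suc n)\<^sup>2"
    by (rule le_imp_power_dvd) (simp add: power2_eq_square)
  moreover have "fps_X ^ Suc n dvd (\<Sum>k=1..n. fps_X ^ (k\<^sup>2 + k * n) * (g k * p k))"
  proof (rule dvd_sum)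
    fix k assume "k \<in> {1..n}"
    then have "Suc n \<le> k\<^sup>2 + k * n"
      by (cases k) (simp_all add: power2_eq_square)
    then show "fps_X ^ Suc n dvd fps_X ^ (k\<^sup>2 + k * n) * (g k * p k)"
      by (intro dvd_mult2 le_imp_power_dvd)
  qed
  moreover have "(\<Sum>l=1..n. (- 1) ^ (l - 1) * fps_X ^ l * (\<Prod>k=1..l. inverse (1 + fps_X ^ k :: rat fps)))
    - (\<Sum>k=1..n. fps_X ^ k\<^sup>2 * p k)
    = fps_X ^ (Suc n)\<^sup>2 * (p n * inverse (1 + fps_X ^ Suc n)
          * (\<Sum>l\<le>L. (- 1) ^ l * fps_X ^ (Suc n * l) * (\<Prod>k<l. inverse (1 + fps_X ^ (Suc n + Suc k)))))
      - (\<Sum>k=1..n. fps_X ^ (k\<^sup>2 + k * n) * (g k * p k))"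
  proof -
    have "(\<Sum>k=1..n. fps_X ^ k\<^sup>2 * (1 - (- 1) ^ n * fps_X ^ (k * n) * (\<Prod>j<n. inverse (1 + fps_X ^ (k + Suc j)))) * p k)
      = (\<Sum>k=1..n. fps_X ^ k\<^sup>2 * p k) - (\<Sum>k=1..n. fps_X ^ (k\<^sup>2 + k * n) * (g k * p k))"
      unfolding sum_subtractf [symmetric] g_def power_add
      by (intro sum.cong refl) (simp only: ring_distribs mult_ac mult_1_left mult_1_right)
    moreover have "a + b - c - a = b - c" for a b c :: "rat fps"
      by simp
    ultimately show ?thesis
      using alternating_fps_eq[of L n]
      unfolding L [symmetric] p_def [symmetric] by (simp only: mult.assoc diff_add_eq)
  qed
  ultimately show "fps_X ^ Suc n dvd
      (\<Sum>l=1..n. (- 1) ^ (l - 1) * fps_X ^ l * (\<Prod>k=1..l. inverse (1 + fps_X ^ k :: rat fps)))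
    - (\<Sum>k=1..n. fps_X ^ k\<^sup>2 * (\<Prod>j=1..k. inverse (1 + fps_X ^ j :: rat fps))\<^sup>2)"
    unfolding p_def [symmetric] by (simp only: dvd_diff dvd_mult2)
qed simp

lemma two_color_nth_eq:
  assumes "0 < n"
  shows "4 * (\<Sum>m=1..n. fps_X ^ (2 * m) * (\<Prod>k=2*m..2*n. inverse (1 - fps_X ^ k))
          * (\<Prod>j=1..m. inverse (1 - fps_X ^ (2 * (m + j)) :: rat fps))) $ n
    = (\<Prod>k=1..2*n. inverse (1 - fps_X ^ k)) $ n
      - (\<Sum>l=1..n. (- 1) ^ (l - 1) * fps_X ^ l * (\<Prod>k=1..l. inverse (1 + fps_X ^ k))) $ n"
proof -
  \<comment> \<open>The summand k = 0 is 1 and affects only the constant coefficient, which n > 0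
    excludes.\<close>
  have "(\<Sum>k\<le>n. fps_X ^ k\<^sup>2 * (\<Prod>j=1..k. inverse (1 + fps_X ^ j :: rat fps))\<^sup>2)
      = 1 + (\<Sum>k=1..n. fps_X ^ k\<^sup>2 * (\<Prod>j=1..k. inverse (1 + fps_X ^ j))\<^sup>2)"
    by (simp add: sum.atMost_shift sum.atLeast1_atMost_eq)
  then have "(\<Sum>k\<le>n. fps_X ^ k\<^sup>2 * (\<Prod>j=1..k. inverse (1 + fps_X ^ j :: rat fps))\<^sup>2) $ n
      = (\<Sum>l=1..n. (- 1) ^ (l - 1) * fps_X ^ l * (\<Prod>k=1..l. inverse (1 + fps_X ^ k))) $ n"
    using assms by (simp only: alternating_nth_eq [OF assms]) simp
  moreover have "(4 * f) $ n = 4 * f $ n" for f :: "rat fps"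
    by (simp add: numeral_fps_const)
  ultimately show ?thesis
    using arg_cong [OF two_color_fps_eq[of n], of "\<lambda>f. f $ n"]
    unfolding fps_sub_nth durfee_nth_eq by (simp only:)
qed

subsection \<open>Generating functions of weighted multisets\<close>

text \<open>The weight is a parameter so that one theory serves plain partitions (\<open>id\<close>)
  and coloured ones (\<open>snd\<close>).\<close>

definition weighted_msets :: "'a set \<Rightarrow> ('a \<Rightarrow> nat) \<Rightarrow> nat \<Rightarrow> 'a multiset set" where
  "weighted_msets S w n = {p. set_mset p \<subseteq> S \<and> (\<Sum>x\<in>#p. w x) = n}"

lemma size_le_weight:
  fixes w :: "'a \<Rightarrow> nat"
  assumes "\<And>x. x \<in># p \<Longrightarrow> 0 < w x"
  shows "size p \<le> (\<Sum>x\<in>#p. w x)"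
  using assms
proof (induction p)
  case (add x p)
  then show ?case
    using add.prems[of x] by (simp add: Suc_le_eq add_strict_increasing)
qed simp

lemma finite_weighted_msets:
  assumes "finite S" "\<And>x. x \<in> S \<Longrightarrow> 0 < w x"
  shows "finite (weighted_msets S w n)"
proof -
  have "weighted_msets S w n \<subseteq> (\<Union>k\<le>n. multisets_of_size S k)"
    using assms(2) by (auto simp: weighted_msets_def multisets_of_size_def subset_iff intro!: size_le_weight)
  moreover have "finite (\<Union>k\<le>n. multisets_of_size S k)"
    using assms(1) by auto
  ultimately show ?thesis
    by (rule finite_subset)
qed

lemma weighted_msets_containing:
  "{p \<in> weighted_msets S w n. x \<in># p} =
    (if x \<in> S \<and> w x \<le> n then add_mset x ` weighted_msets S w (n - w x) else {})"
proof -
  have "p \<in> add_mset x ` weighted_msets S w (n - w x) \<and> x \<in> S \<and> w x \<le> n"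
    if p: "p \<in> weighted_msets S w n" "x \<in># p" for p
  proof -
    obtain p' where "p = add_mset x p'"
      using p(2) by (meson mset_add)
    then show ?thesis
      using p by (auto simp: weighted_msets_def)
  qed
  then show ?thesis
    by (auto simp: weighted_msets_def split: if_splits)
qed

lemma weighted_msets_insert:
  assumes "x \<notin> S"
  shows "weighted_msets (insert x S) w n =
    weighted_msets S w n \<union> {p \<in> weighted_msets (insert x S) w n. x \<in># p}"
    "weighted_msets S w n \<inter> {p \<in> weighted_msets (insert x S) w n. x \<in># p} = {}"
  using assms by (auto simp: weighted_msets_def)

text \<open>Multisets containing x correspond, by removing one copy of it, to multisets of weight
  smaller by w x in which x may still occur.\<close>

lemma sum_weighted_msets_insert:
  assumes "finite S" "\<And>y. y \<in> insert x S \<Longrightarrow> 0 < w y" "x \<notin> S"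
  shows "(\<Sum>p\<in>weighted_msets (insert x S) w n. f p) = (\<Sum>p\<in>weighted_msets S w n. f p)
    + (if w x \<le> n then \<Sum>p\<in>weighted_msets (insert x S) w (n - w x). f (add_mset x p) else 0)"
proof -
  have fin: "finite (weighted_msets S w n)" "finite (weighted_msets (insert x S) w k)" for k
    using assms by (auto intro: finite_weighted_msets)
  have "inj_on (add_mset x) A" for A
    by (rule inj_onI) simp
  then have "(\<Sum>p\<in>{p \<in> weighted_msets (insert x S) w n. x \<in># p}. f p)
      = (if w x \<le> n then \<Sum>p\<in>weighted_msets (insert x S) w (n - w x). f (add_mset x p) else 0)"
    unfolding weighted_msets_containing by (simp add: sum.reindex)
  then show ?thesis
    using fin by (subst weighted_msets_insert(1)[OF assms(3)], subst sum.union_disjoint)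
      (auto simp: weighted_msets_insert(2)[OF assms(3)])
qed

text \<open>The variable c marks the number of parts: c = 1 counts, c = -1 gives signs. Removing one
  copy of x shows that the series F for \<open>insert x S\<close> satisfies F = F_S + c X^(w x) F,
  which is solved for F.\<close>

lemma weighted_msets_gf:
  fixes c :: "'b::field"
  assumes "finite S" "\<And>x. x \<in> S \<Longrightarrow> 0 < w x"
  shows "(\<Prod>x\<in>S. inverse (1 - fps_const c * fps_X ^ w x)) =
    Abs_fps (\<lambda>n. \<Sum>p\<in>weighted_msets S w n. c ^ size p)"
  using assms
proof (induction S rule: finite_induct)
  case empty
  have "weighted_msets {} w n = (if n = 0 then {{#}} else {})" for n
    by (auto simp: weighted_msets_def)
  then show ?case
    by (intro fps_ext) (simp add: if_distrib cong: if_cong)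
next
  case (insert x S)
  let ?A = "\<lambda>S. Abs_fps (\<lambda>n. \<Sum>p\<in>weighted_msets S w n. c ^ size p)"
  have unit: "(1 - fps_const c * fps_X ^ w x) $ 0 \<noteq> 0"
    using insert.prems[of x] by simp
  have rec: "(\<Sum>p\<in>weighted_msets (insert x S) w n. c ^ size p) = (\<Sum>p\<in>weighted_msets S w n. c ^ size p)
      + (if w x \<le> n then \<Sum>p\<in>weighted_msets (insert x S) w (n - w x). c ^ size (add_mset x p) else 0)" for n
    by (rule sum_weighted_msets_insert) (use insert.hyps insert.prems in auto)
  have "?A (insert x S) = ?A S + fps_const c * fps_X ^ w x * ?A (insert x S)"
  proof (rule fps_ext)
    fix n
    show "?A (insert x S) $ n = (?A S + fps_const c * fps_X ^ w x * ?A (insert x S)) $ n"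
      by (simp add: rec[of n] mult.assoc fps_X_power_mult_nth not_less sum_distrib_left)
  qed
  then have "?A S = ?A (insert x S) * (1 - fps_const c * fps_X ^ w x)"
    by (simp add: algebra_simps)
  then have "?A S * inverse (1 - fps_const c * fps_X ^ w x) = ?A (insert x S)"
    using inverse_mult_eq_1'[OF unit] by (simp add: mult.assoc)
  then show ?case
    using insert by (simp add: mult.commute)
qed

lemma card_weighted_msets:
  assumes "finite S" "\<And>x. x \<in> S \<Longrightarrow> 0 < w x"
  shows "(of_nat (card (weighted_msets S w n)) :: 'b::field) = (\<Prod>x\<in>S. inverse (1 - fps_X ^ w x)) $ n"
  using weighted_msets_gf[OF assms, where c = "1 :: 'b"] by simp

section \<open>Gaussian binomials and the symmetry of largest part and number of parts\<close>

definition bounded_gf :: "nat \<Rightarrow> nat \<Rightarrow> rat fps" where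
  "bounded_gf l k = Abs_fps (\<lambda>n. \<Sum>p\<in>weighted_msets {1..l} id n. if size p = k then 1 else 0)"

text \<open>
  Up to the factor \<open>fps_X ^ k\<close>, \<^term>\<open>bounded_gf (Suc l) k\<close> is the Gaussian binomial coefficient of
  \<open>l + k\<close> over \<open>k\<close>; its symmetry replaces conjugation of partitions.
\<close>

lemma bounded_gf_0_right: "bounded_gf l 0 = 1"
proof (rule fps_ext)
  fix n
  have "finite (weighted_msets {1..l} id n)"
    by (rule finite_weighted_msets) auto
  then show "bounded_gf l 0 $ n = 1 $ n"
    by (auto simp: bounded_gf_def weighted_msets_def)
qed

lemma bounded_gf_0_left: "bounded_gf 0 (Suc k) = 0"
proof (rule fps_ext)
  fix n
  have "weighted_msets {} id n = (if n = 0 then {{#}} else {})"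
    by (auto simp: weighted_msets_def)
  then show "bounded_gf 0 (Suc k) $ n = 0 $ n"
    by (simp add: bounded_gf_def)
qed

text \<open>The q-Pascal rule: either l+1 does not occur as a part, or one copy of it is
  removed.\<close>

lemma bounded_gf_Suc_Suc:
  "bounded_gf (Suc l) (Suc k) = bounded_gf l (Suc k) + fps_X ^ Suc l * bounded_gf (Suc l) k"
proof (rule fps_ext)
  fix n
  have atMost_Suc: "{1..Suc l} = insert (Suc l) {1..l}"
    by auto
  have rec: "(\<Sum>p\<in>weighted_msets (insert (Suc l) {1..l}) id n. f p) = (\<Sum>p\<in>weighted_msets {1..l} id n. f p)
      + (if id (Suc l) \<le> n then \<Sum>p\<in>weighted_msets (insert (Suc l) {1..l}) id (n - id (Suc l)). f (add_mset (Suc l) p) else 0)"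
    for f :: "nat multiset \<Rightarrow> rat"
    by (rule sum_weighted_msets_insert) auto
  show "bounded_gf (Suc l) (Suc k) $ n =
      (bounded_gf l (Suc k) + fps_X ^ Suc l * bounded_gf (Suc l) k) $ n"
    unfolding bounded_gf_def atMost_Suc fps_nth_Abs_fps fps_add_nth fps_X_power_mult_nth
    by (simp only: rec) simp
qed

text \<open>The product formula with denominators cleared. The q-Pascal rule lowers either l or k,
  hence the nested inductions, the outer one for all l.\<close>

lemma bounded_gf_qfact:
  "bounded_gf (Suc l) k * (qfact fps_X l * qfact fps_X k) = fps_X ^ k * qfact fps_X (l + k)"
proof (induction k arbitrary: l)
  case 0
  then show ?case by (simp add: bounded_gf_0_right)
next
  case (Suc k)
  note IH = Suc.IH
  show ?case
  proof (induction l)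
    case 0
    have "bounded_gf (Suc 0) (Suc k) * (qfact fps_X 0 * qfact fps_X (Suc k))
        = fps_X * (bounded_gf (Suc 0) k * (qfact fps_X 0 * qfact fps_X k)) * (1 - fps_X ^ Suc k)"
      unfolding bounded_gf_Suc_Suc bounded_gf_0_left by (simp add: mult.assoc)
    also have "\<dots> = fps_X ^ Suc k * qfact fps_X (0 + Suc k)"
      unfolding IH by (simp add: mult.assoc)
    finally show ?case .
  next
    case (Suc l)
    define a b c d where "a = qfact (fps_X :: rat fps) l" and "b = qfact (fps_X :: rat fps) k"
      and "c = bounded_gf (Suc l) (Suc k)" and "d = bounded_gf (Suc (Suc l)) k"
    define r z x y where "r = qfact (fps_X :: rat fps) (Suc (l + k))" and "z = (fps_X :: rat fps) ^ k"
      and "x = (fps_X :: rat fps) ^ Suc l" and "y = (fps_X :: rat fps) ^ Suc k"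
    have "c * (a * (b * (1 - y))) = y * r"
      using Suc.IH by (simp add: a_def b_def c_def r_def y_def)
    moreover have "d * (a * (1 - x) * b) = z * r"
      using IH[of "Suc l"] by (simp add: a_def b_def d_def r_def x_def z_def)
    moreover have "(c + fps_X * x * d) * (a * (1 - x) * (b * (1 - y)))
        = c * (a * (b * (1 - y))) * (1 - x) + fps_X * x * (d * (a * (1 - x) * b)) * (1 - y)"
      by (simp add: algebra_simps)
    moreover have "fps_X * x * (z * r) * (1 - y) = y * r * (x * (1 - y))"
      by (simp add: y_def z_def mult_ac)
    \<comment> \<open>The factorial form of the q-Pascal rule: (1 - x) + x*(1 - y) = 1 -
      x*y.\<close>
    moreover have "y * r * (1 - x) + y * r * (x * (1 - y)) = y * (r * (1 - x * y))"
      by (simp add: algebra_simps)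
    ultimately have "(c + fps_X * x * d) * (a * (1 - x) * (b * (1 - y))) = y * (r * (1 - x * y))"
      by (simp only:)
    moreover have "bounded_gf (Suc (Suc l)) (Suc k) = c + fps_X * x * d"
      unfolding c_def d_def x_def by (subst bounded_gf_Suc_Suc) simp
    moreover have "qfact (fps_X :: rat fps) (Suc l) = a * (1 - x)" "qfact (fps_X :: rat fps) (Suc k) = b * (1 - y)"
      by (simp_all only: qfact_simps a_def b_def x_def y_def)
    moreover have "qfact (fps_X :: rat fps) (Suc l + Suc k) = r * (1 - x * y)"
      unfolding r_def x_def y_def power_add [symmetric] by (simp del: power_Suc)
    ultimately show ?case
      by (simp only: y_def)
  qed
qed

lemma qfact_fps_X_neq_0: "qfact (fps_X :: rat fps) n \<noteq> 0"
proof -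
  have "(1 - fps_X ^ k :: rat fps) \<noteq> 0" if "0 < k" for k
  proof
    assume "(1 - fps_X ^ k :: rat fps) = 0"
    then have "(1 - fps_X ^ k :: rat fps) $ 0 = 0"
      by (simp only: fps_zero_nth)
    then show False using that by simp
  qed
  then show ?thesis by (auto simp: qfact_def)
qed

text \<open>Multiplied by (q)_l (q)_k at q = X, both sides become X^(l+k+1) (q)_(l+k), which is
  symmetric in l and k.\<close>

lemma bounded_gf_sym: "fps_X ^ Suc l * bounded_gf (Suc l) k = fps_X ^ Suc k * bounded_gf (Suc k) l"
proof -
  let ?Q = "qfact (fps_X :: rat fps) l * qfact fps_X k"
  have "fps_X ^ Suc l * bounded_gf (Suc l) k * ?Q = fps_X ^ (Suc l + k) * qfact fps_X (l + k)"
    by (simp only: mult.assoc bounded_gf_qfact power_add)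
  also have "\<dots> = fps_X ^ Suc k * bounded_gf (Suc k) l * (qfact fps_X k * qfact fps_X l)"
    by (simp only: mult.assoc bounded_gf_qfact) (simp add: power_add mult_ac add.commute)
  finally show ?thesis
    using qfact_fps_X_neq_0 by (simp add: mult_ac)
qed

subsection \<open>Counting partitions by rank\<close>

lemma member_le_sum_mset: "x \<in># p \<Longrightarrow> w x \<le> (\<Sum>y\<in>#p. w y :: nat)"
  by (drule multi_member_split) auto

text \<open>The cap N is left free: N = n gives finiteness, and N = 2n matches the product in
  \<open>two_color_nth_eq\<close>.\<close>

lemma int_partitions_eq_weighted_msets:
  assumes "n \<le> N"
  shows "int_partitions n = weighted_msets {1..N} id n"
proof -
  have "x \<le> N" if "x \<in># p" "\<Sum>\<^sub># p = n" for x p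
    using member_le_sum_mset[of x p id] that assms by simp
  then show ?thesis
    by (fastforce simp: int_partitions_def weighted_msets_def Suc_le_eq)
qed

lemma int_partitions_nonempty: "p \<in> int_partitions n \<Longrightarrow> 0 < n \<Longrightarrow> p \<noteq> {#}"
  by (auto simp: int_partitions_def)

lemma finite_int_partitions: "finite (int_partitions n)"
  unfolding int_partitions_eq_weighted_msets[OF order_refl] by (rule finite_weighted_msets) auto

lemma int_partitions_Max_le:
  assumes "p \<in> int_partitions n" "0 < n"
  shows "Max (set_mset p) \<in> {1..n}" "size p \<in> {1..n}"
proof -
  have "Max (set_mset p) \<in># p"
    using int_partitions_nonempty[OF assms] by (intro Max_in) auto
  then show "Max (set_mset p) \<in> {1..n}"
    using assms(1) by (auto simp: int_partitions_eq_weighted_msets[OF order_refl] weighted_msets_def)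
  have "size p \<le> n"
    using size_le_weight[of p id] assms(1) by (simp add: int_partitions_def)
  moreover have "0 < size p"
    using int_partitions_nonempty[OF assms] by (simp add: nonempty_has_size)
  ultimately show "size p \<in> {1..n}" by (simp add: Suc_le_eq)
qed

lemma int_partitions_with_Max:
  assumes "0 < n" "0 < l"
  shows "{p \<in> int_partitions n. Max (set_mset p) = l} =
    (if l \<le> n then add_mset l ` weighted_msets {1..l} id (n - l) else {})"
proof -
  have "Max (set_mset p) = l \<longleftrightarrow> set_mset p \<subseteq> {1..l} \<and> l \<in># p" if "p \<in> int_partitions n" for p
  proof -
    have "set_mset p \<noteq> {}" "\<forall>x\<in>#p. 0 < x"
      using int_partitions_nonempty[OF that assms(1)] that by (auto simp: int_partitions_def)
    then show ?thesis
      by (subst Max_eq_iff) (auto simp: Suc_le_eq)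
  qed
  moreover have "p \<in> int_partitions n" if "p \<in> weighted_msets {1..l} id n" for p
    using that by (auto simp: int_partitions_def weighted_msets_def)
  moreover have "\<Sum>\<^sub># (image_mset id p) = n" if "p \<in> int_partitions n" for p
    using that by (simp add: int_partitions_def)
  ultimately have "{p \<in> int_partitions n. Max (set_mset p) = l} = {p \<in> weighted_msets {1..l} id n. l \<in># p}"
    unfolding weighted_msets_def by blast
  then show ?thesis
    using assms(2) by (simp add: weighted_msets_containing)
qed

text \<open>Removing one copy of the largest part l+1 leaves k parts, all at most l+1.\<close>

lemma card_Max_size:
  assumes "0 < n"
  shows "of_nat (card {p \<in> int_partitions n. Max (set_mset p) = Suc l \<and> size p = Suc k})
    = (fps_X ^ Suc l * bounded_gf (Suc l) k) $ n"
proof -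
  have "{p \<in> int_partitions n. Max (set_mset p) = Suc l \<and> size p = Suc k}
      = {p \<in> {p \<in> int_partitions n. Max (set_mset p) = Suc l}. size p = Suc k}"
    by auto
  also have "\<dots> = (if Suc l \<le> n then
      add_mset (Suc l) ` {p \<in> weighted_msets {1..Suc l} id (n - Suc l). size p = k} else {})"
    unfolding int_partitions_with_Max[OF assms zero_less_Suc] by auto
  finally have eq: "{p \<in> int_partitions n. Max (set_mset p) = Suc l \<and> size p = Suc k} = \<dots>" .
  have "card (add_mset (Suc l) ` A) = card A" for A
    by (rule card_image) (simp add: inj_on_def)
  moreover have "finite (weighted_msets {1..Suc l} id m)" for m
    by (rule finite_weighted_msets) auto
  then have "bounded_gf (Suc l) k $ m = of_nat (card {p \<in> weighted_msets {1..Suc l} id m. size p = k})" for m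
    unfolding bounded_gf_def fps_nth_Abs_fps by (subst sum.inter_filter [symmetric]) simp_all
  ultimately show ?thesis
    unfolding eq fps_X_power_mult_nth by simp
qed

lemma card_Max_size_sym:
  assumes "0 < n" "0 < a" "0 < b"
  shows "card {p \<in> int_partitions n. Max (set_mset p) = a \<and> size p = b}
    = card {p \<in> int_partitions n. Max (set_mset p) = b \<and> size p = a}"
proof -
  obtain l k where [simp]: "a = Suc l" "b = Suc k"
    using assms gr0_conv_Suc by metis
  have "(of_nat (card {p \<in> int_partitions n. Max (set_mset p) = a \<and> size p = b}) :: rat)
      = of_nat (card {p \<in> int_partitions n. Max (set_mset p) = b \<and> size p = a})"
    unfolding \<open>a = Suc l\<close> \<open>b = Suc k\<close> card_Max_size[OF assms(1)] bounded_gf_sym[of l k] ..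
  then show ?thesis
    by (simp only: of_nat_eq_iff)
qed

lemma card_Max_size_in:
  assumes "0 < n" "T \<subseteq> {1..n} \<times> {1..n}"
  shows "card {p \<in> int_partitions n. (Max (set_mset p), size p) \<in> T}
    = (\<Sum>(a, b)\<in>T. card {p \<in> int_partitions n. Max (set_mset p) = a \<and> size p = b})"
proof -
  have fin: "finite T"
    using assms(2) by (rule finite_subset) simp
  have "card {p \<in> int_partitions n. (Max (set_mset p), size p) \<in> T}
      = card (\<Union>t\<in>T. {p \<in> int_partitions n. Max (set_mset p) = fst t \<and> size p = snd t})"
    by (rule arg_cong[of _ _ card]) auto
  also have "\<dots> = (\<Sum>t\<in>T. card {p \<in> int_partitions n. Max (set_mset p) = fst t \<and> size p = snd t})"
    using fin finite_int_partitions by (intro card_UN_disjoint) (auto simp: prod_eq_iff)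
  finally show ?thesis
    by (simp add: case_prod_unfold)
qed

text \<open>Swapping largest part and number of parts negates the rank, and
  \<open>card_Max_size_sym\<close> says that the swap preserves each count.\<close>

lemma card_negative_odd_rank:
  assumes "0 < n"
  shows "card {p \<in> int_partitions n. partition_rank p < 0 \<and> odd (partition_rank p)} = No_plus n"
proof -
  define T where "T = {(a, b). a \<in> {1..n} \<and> b \<in> {1..n} \<and> b < a \<and> odd (int a - int b)}"
  have conv: "{p \<in> int_partitions n. 0 < partition_rank p \<and> odd (partition_rank p)}
      = {p \<in> int_partitions n. (Max (set_mset p), size p) \<in> T}"
    "{p \<in> int_partitions n. partition_rank p < 0 \<and> odd (partition_rank p)}
      = {p \<in> int_partitions n. (Max (set_mset p), size p) \<in> prod.swap ` T}"
    using int_partitions_Max_le[OF _ assms] by (auto simp: T_def partition_rank_def image_iff)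
  have "T \<subseteq> {1..n} \<times> {1..n}" "prod.swap ` T \<subseteq> {1..n} \<times> {1..n}"
    by (auto simp: T_def)
  then have "card {p \<in> int_partitions n. partition_rank p < 0 \<and> odd (partition_rank p)}
      = (\<Sum>(a, b)\<in>prod.swap ` T. card {p \<in> int_partitions n. Max (set_mset p) = a \<and> size p = b})"
    unfolding conv by (intro card_Max_size_in assms)
  also have "\<dots> = (\<Sum>(a, b)\<in>T. card {p \<in> int_partitions n. Max (set_mset p) = b \<and> size p = a})"
    by (subst sum.reindex) (auto simp: inj_on_def case_prod_unfold)
  also have "\<dots> = (\<Sum>(a, b)\<in>T. card {p \<in> int_partitions n. Max (set_mset p) = a \<and> size p = b})"
    using card_Max_size_sym[OF assms] by (intro sum.cong) (auto simp: T_def)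
  also have "\<dots> = No_plus n"
    unfolding No_plus_def conv using \<open>T \<subseteq> _\<close> by (intro card_Max_size_in [symmetric] assms)
  finally show ?thesis .
qed

text \<open>The exponent has the parity of the rank, so the sign is 1 - 2 on odd ranks and 1 on even
  ones. An odd rank is nonzero, and its two signs are equally frequent, so there are 2 N_o^+(n) odd
  ranks.\<close>

lemma sum_sign_rank:
  assumes "0 < n"
  shows "(\<Sum>p\<in>int_partitions n. (- 1) ^ (Max (set_mset p) + size p))
    = of_nat (card (int_partitions n)) - 4 * (of_nat (No_plus n) :: rat)"
proof -
  let ?O = "{p \<in> int_partitions n. odd (partition_rank p)}"
  have "odd r \<longleftrightarrow> 0 < r \<and> odd r \<or> r < 0 \<and> odd r" for r :: int
    by (cases r "0 :: int" rule: linorder_cases) auto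
  then have "?O = {p \<in> int_partitions n. 0 < partition_rank p \<and> odd (partition_rank p)}
      \<union> {p \<in> int_partitions n. partition_rank p < 0 \<and> odd (partition_rank p)}"
    by blast
  then have "card ?O = No_plus n + No_plus n"
    unfolding No_plus_def card_negative_odd_rank[OF assms, unfolded No_plus_def, symmetric]
    using finite_int_partitions
    by (simp add: card_Un_disjoint disjoint_iff card_negative_odd_rank[OF assms, unfolded No_plus_def])
  moreover have "(- 1) ^ (Max (set_mset p) + size p) = 1 - 2 * (if odd (partition_rank p) then 1 else 0 :: rat)" for p
    by (auto simp: partition_rank_def minus_one_power_iff)
  moreover have "(\<Sum>p\<in>int_partitions n. if odd (partition_rank p) then 1 else 0 :: rat) = of_nat (card ?O)"
    using finite_int_partitions by (subst sum.inter_filter [symmetric]) simp_all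
  ultimately show ?thesis
    by (simp add: sum_subtractf sum_distrib_left [symmetric])
qed

text \<open>Partitions are grouped by largest part l. Removing one copy of l gives X^l and changes
  the number of parts by one, which accounts for the exponent l - 1 in place of l.\<close>

lemma sum_sign_rank_gf:
  assumes "0 < n"
  shows "(\<Sum>l=1..n. (- 1) ^ (l - 1) * fps_X ^ l * (\<Prod>k=1..l. inverse (1 + fps_X ^ k :: rat fps))) $ n
    = (\<Sum>p\<in>int_partitions n. (- 1) ^ (Max (set_mset p) + size p))"
proof -
  have "((- 1) ^ (l - 1) * fps_X ^ l * (\<Prod>k=1..l. inverse (1 + fps_X ^ k :: rat fps))) $ n
    = (\<Sum>p\<in>{p \<in> int_partitions n. Max (set_mset p) = l}. (- 1) ^ (Max (set_mset p) + size p))"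
    if l: "l \<in> {1..n}" for l
  proof -
    have "(\<Prod>k=1..l. inverse (1 + fps_X ^ k :: rat fps))
        = (\<Prod>k=1..l. inverse (1 - fps_const (- 1) * fps_X ^ id k))"
      by (simp flip: fps_const_neg)
    also have "\<dots> = Abs_fps (\<lambda>n. \<Sum>p\<in>weighted_msets {1..l} id n. (- 1) ^ size p)"
      by (rule weighted_msets_gf) auto
    finally have gf: "(\<Prod>k=1..l. inverse (1 + fps_X ^ k :: rat fps)) = \<dots>" .
    have "((- 1) ^ i * fps_X ^ l * f) $ n = (- 1) ^ i * f $ (n - l)" for f :: "rat fps" and i
      using l by (cases "even i") (simp_all add: fps_X_power_mult_nth)
    then have "((- 1) ^ (l - 1) * fps_X ^ l * (\<Prod>k=1..l. inverse (1 + fps_X ^ k :: rat fps))) $ n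
        = (\<Sum>p\<in>weighted_msets {1..l} id (n - l). (- 1) ^ (l - 1) * (- 1) ^ size p)"
      unfolding gf by (simp add: sum_distrib_left)
    also have "\<dots> = (\<Sum>p\<in>weighted_msets {1..l} id (n - l). (- 1) ^ (l + size (add_mset l p)))"
      using l by (cases l) (auto simp: power_add)
    also have "\<dots> = (\<Sum>p\<in>{p \<in> int_partitions n. Max (set_mset p) = l}. (- 1) ^ (l + size p))"
      using l assms by (simp add: int_partitions_with_Max sum.reindex inj_on_def)
    also have "\<dots> = (\<Sum>p\<in>{p \<in> int_partitions n. Max (set_mset p) = l}. (- 1) ^ (Max (set_mset p) + size p))"
      by (intro sum.cong) auto
    finally show ?thesis .
  qed
  then have "(\<Sum>l=1..n. (- 1) ^ (l - 1) * fps_X ^ l * (\<Prod>k=1..l. inverse (1 + fps_X ^ k :: rat fps))) $ n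
    = (\<Sum>l=1..n. \<Sum>p\<in>{p \<in> int_partitions n. Max (set_mset p) = l}. (- 1) ^ (Max (set_mset p) + size p))"
    by (simp only: fps_sum_nth cong: sum.cong)
  also have "\<dots> = (\<Sum>p\<in>int_partitions n. (- 1) ^ (Max (set_mset p) + size p))"
    using int_partitions_Max_le[OF _ assms] by (intro sum.group finite_int_partitions) auto
  finally show ?thesis .
qed

subsection \<open>Counting two-colour partitions\<close>

text \<open>The even numbers in (2m, 4m] are 2(m+j) with 1 <= j <= m. The blue cap 2n is harmless,
  since no part of a partition of n exceeds n, and it agrees with the product in
  \<open>two_color_nth_eq\<close>.\<close>

definition admissible_parts :: "nat \<Rightarrow> nat \<Rightarrow> (part_color \<times> nat) set" where
  "admissible_parts n m = Pair Blue ` {2*m..2*n} \<union> (\<lambda>j. (Red, 2 * (m + j))) ` {1..m}"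

lemma prod_admissible_parts:
  "(\<Prod>x\<in>admissible_parts n m. f (snd x)) = (\<Prod>k=2*m..2*n. f k) * (\<Prod>j=1..m. f (2 * (m + j)))"
proof -
  have "(\<Prod>x\<in>Pair Blue ` {2*m..2*n}. f (snd x)) = (\<Prod>k=2*m..2*n. f k)"
    "(\<Prod>x\<in>(\<lambda>j. (Red, 2 * (m + j))) ` {1..m}. f (snd x)) = (\<Prod>j=1..m. f (2 * (m + j)))"
    by (simp_all add: prod.reindex inj_on_def)
  then show ?thesis
    unfolding admissible_parts_def by (subst prod.union_disjoint) auto
qed

text \<open>Red parts exceed 2m strictly, so the minimum 2m can only be attained by a blue part.
  Conversely no admissible part is below 2m.\<close>

lemma two_color_smallest_part:
  assumes "0 < n" "0 < m"
  shows "{p \<in> two_color_partitions n. smallest_part p = 2 * m \<and>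
            (\<forall>k. (Red, k) \<in># p \<longrightarrow> even k \<and> k \<in> {2 * m <.. 4 * m})}
    = {p \<in> weighted_msets (admissible_parts n m) snd n. (Blue, 2 * m) \<in># p}" (is "?L = ?R")
proof (intro equalityI subsetI)
  fix p assume "p \<in> ?L"
  then have p: "\<Sum>\<^sub># (image_mset snd p) = n" "Min (snd ` set_mset p) = 2 * m"
    and red: "\<And>k. (Red, k) \<in># p \<Longrightarrow> even k \<and> k \<in> {2 * m <.. 4 * m}"
    by (auto simp: two_color_partitions_def smallest_part_def)
  have "p \<noteq> {#}"
    using p(1) assms(1) by auto
  then have "2 * m \<in> snd ` set_mset p"
    unfolding p(2) [symmetric] by (intro Min_in) auto
  then obtain c where c: "(c, 2 * m) \<in># p"
    by auto
  then have "(Blue, 2 * m) \<in># p"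
    using red[of "2 * m"] by (cases c) auto
  moreover have "x \<in> admissible_parts n m" if x: "x \<in># p" for x
  proof (cases x)
    case (Pair c k)
    have "k \<le> n"
      using member_le_sum_mset[of x p snd] x p(1) Pair by simp
    moreover have "2 * m \<le> k"
      unfolding p(2) [symmetric] using x Pair by (intro Min_le) (auto simp: image_iff intro!: bexI[of _ x])
    moreover have "\<exists>j\<in>{1..m}. k = 2 * (m + j)" if "c = Red"
    proof -
      have "even k" "2 * m < k" "k \<le> 4 * m"
        using red[of k] x Pair that by auto
      then show ?thesis
        by (intro bexI[of _ "k div 2 - m"]) auto
    qed
    ultimately show ?thesis
      using Pair by (cases c) (auto simp: admissible_parts_def)
  qed
  ultimately show "p \<in> ?R"
    using p(1) by (auto simp: weighted_msets_def)
next
  fix p assume p: "p \<in> ?R"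
  then have sub: "\<And>x. x \<in># p \<Longrightarrow> x \<in> admissible_parts n m"
    by (auto simp: weighted_msets_def)
  have "2 * m \<le> snd x" if "x \<in> admissible_parts n m" for x
    using that by (auto simp: admissible_parts_def)
  then have ge: "\<And>x. x \<in># p \<Longrightarrow> 2 * m \<le> snd x"
    using sub by blast
  have "2 * m \<in> snd ` set_mset p"
    using p by (auto simp: image_iff intro!: bexI[of _ "(Blue, 2 * m)"])
  then have "smallest_part p = 2 * m"
    unfolding smallest_part_def using ge by (intro Min_eqI) auto
  moreover have "even k \<and> k \<in> {2 * m <.. 4 * m}" if "(Red, k) \<in># p" for k
    using sub[OF that] by (auto simp: admissible_parts_def)
  moreover have "p \<in> two_color_partitions n"
    using p ge assms(2) by (fastforce simp: two_color_partitions_def weighted_msets_def)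
  ultimately show "p \<in> ?L" by blast
qed

text \<open>The smallest part determines m, so the sets \<open>A m\<close> are disjoint. Removing
  the compulsory blue part 2m gives the factor X^(2m).\<close>

lemma G_count_eq:
  assumes "0 < n"
  shows "of_nat (G_count n) = (\<Sum>m=1..n. fps_X ^ (2 * m) * (\<Prod>k=2*m..2*n. inverse (1 - fps_X ^ k))
          * (\<Prod>j=1..m. inverse (1 - fps_X ^ (2 * (m + j)) :: rat fps))) $ n"
proof -
  define A where "A m = {p \<in> weighted_msets (admissible_parts n m) snd n. (Blue, 2 * m) \<in># p}" for m
  have pos: "0 < snd x" if "m \<in> {1..n}" "x \<in> admissible_parts n m" for m x
    using that by (auto simp: admissible_parts_def)
  have fin_parts: "finite (admissible_parts n m)" for m
    by (simp add: admissible_parts_def)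
  have finA: "finite (A m)" if "m \<in> {1..n}" for m
    using finite_weighted_msets[OF fin_parts pos[OF that], where n = n] by (simp add: A_def)
  have smallest: "smallest_part p = 2 * m" if "p \<in> A m" "m \<in> {1..n}" for p m
    using that two_color_smallest_part[OF assms, of m] unfolding A_def by auto
  have "{p \<in> two_color_partitions n. \<exists>m. smallest_part p = 2 * m \<and>
      (\<forall>k. (Red, k) \<in># p \<longrightarrow> even k \<and> k \<in> {2 * m <.. 4 * m})} = (\<Union>m\<in>{1..n}. A m)"
    (is "?G = _")
  proof (intro equalityI subsetI)
    fix p assume "p \<in> ?G"
    then obtain m where p: "p \<in> two_color_partitions n" "smallest_part p = 2 * m"
      and m: "p \<in> {p \<in> two_color_partitions n. smallest_part p = 2 * m \<and>
            (\<forall>k. (Red, k) \<in># p \<longrightarrow> even k \<and> k \<in> {2 * m <.. 4 * m})}"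
      by blast
    have "p \<noteq> {#}"
      using p(1) assms by (auto simp: two_color_partitions_def)
    then have "2 * m \<in> snd ` set_mset p"
      unfolding p(2) [symmetric] smallest_part_def by (intro Min_in) auto
    then obtain x where "x \<in># p" "snd x = 2 * m"
      by auto
    \<comment> \<open>The smallest part is positive and at most n, which puts m into the range
      1..n.\<close>
    then have "2 * m \<le> n" "0 < m"
      using p(1) member_le_sum_mset[of x p snd] by (auto simp: two_color_partitions_def)
    then show "p \<in> (\<Union>m\<in>{1..n}. A m)"
      using m two_color_smallest_part[OF assms, of m] unfolding A_def by auto
  next
    fix p assume "p \<in> (\<Union>m\<in>{1..n}. A m)"
    then obtain m where "m \<in> {1..n}" "p \<in> A m"
      by blast
    then have "0 < m" "p \<in> A m"
      by simp_all
    then show "p \<in> ?G"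
      using two_color_smallest_part[OF assms, of m] unfolding A_def by blast
  qed
  then have "G_count n = card (\<Union>m\<in>{1..n}. A m)"
    by (simp only: G_count_def)
  also have "\<dots> = (\<Sum>m=1..n. card (A m))"
  proof (rule card_UN_disjoint)
    show "\<forall>i\<in>{1..n}. \<forall>j\<in>{1..n}. i \<noteq> j \<longrightarrow> A i \<inter> A j = {}"
    proof (intro ballI impI equals0I)
      fix i j p assume "i \<in> {1..n}" "j \<in> {1..n}" "i \<noteq> j" "p \<in> A i \<inter> A j"
      then show False
        using smallest[of p i] smallest[of p j] by simp
    qed
  qed (use finA in auto)
  finally have "G_count n = (\<Sum>m=1..n. card (A m))" .
  moreover have "of_nat (card (A m)) = (fps_X ^ (2 * m) * (\<Prod>k=2*m..2*n. inverse (1 - fps_X ^ k))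
          * (\<Prod>j=1..m. inverse (1 - fps_X ^ (2 * (m + j)) :: rat fps))) $ n" if m: "m \<in> {1..n}" for m
  proof -
    have "(Blue, 2 * m) \<in> admissible_parts n m"
      using m by (auto simp: admissible_parts_def)
    moreover have "card (add_mset (Blue, 2 * m) ` B) = card B" for B
      by (rule card_image) (simp add: inj_on_def)
    ultimately have "card (A m) = (if 2 * m \<le> n then card (weighted_msets (admissible_parts n m) snd (n - 2 * m)) else 0)"
      unfolding A_def weighted_msets_containing by simp
    then show ?thesis
      using card_weighted_msets[OF fin_parts pos[OF m], where 'b = rat and n = "n - 2 * m"]
        prod_admissible_parts[of "\<lambda>k. inverse (1 - fps_X ^ k :: rat fps)" n m]
      by (simp add: mult.assoc fps_X_power_mult_nth)
  qed
  ultimately show ?thesis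
    by (simp add: fps_sum_nth)
qed

theorem theorem1p2:
  fixes n :: nat
  assumes "n \<ge> 1"
  shows "No_plus n = G_count n"
proof -
  have n: "0 < n"
    using assms by simp
  have "of_nat (card (int_partitions n)) = (\<Prod>k=1..2*n. inverse (1 - fps_X ^ k :: rat fps)) $ n"
    using card_weighted_msets[of "{1..2*n}" id n, where 'b = rat]
      int_partitions_eq_weighted_msets[of n "2 * n"] by simp
  \<comment> \<open>With p(n) the number of partitions of n, this reads 4 G(n) = p(n) - (p(n) - 4
    N_o^+(n)).\<close>
  then have "4 * (of_nat (G_count n) :: rat) = 4 * of_nat (No_plus n)"
    using two_color_nth_eq[OF n] unfolding G_count_eq[OF n] sum_sign_rank_gf[OF n] sum_sign_rank[OF n]
    by simp
  then show ?thesis by simp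
qed

end
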